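(* Neither $\mathtt{A^+S^*S^+}$ nor $\mathtt{S^+S^*S^+}$ occurs as a subsequence of the sepr-sequence of any Hermitian matrix.
   Context: Let $B \in \mathbb{C}^{n\times n}$ be Hermitian. For $\alpha\subseteq\{1,\dots,n\}$ with $|\alpha|=k\ge 1$, the determinant of the submatrix $B[\alpha]$ lying in the rows and columns indexed by $\alpha$ is a principal minor of order $k$ (it is a real number). The signed enhanced principal rank characteristic sequence (sepr-sequence) of $B$ is $\operatorname{sepr}(B)=t_1t_2\cdots t_n$, where each $t_k$ is one of the seven symbols $\mathtt{A^*},\mathtt{A^+},\mathtt{A^-},\mathtt{N},\mathtt{S^*},\mathtt{S^+},\mathtt{S^-}$, determined as follows: - $t_k=\mathtt{A^*}$ if all order-$k$ principal minors of $B$ are nonzero and there are both positive and negative ones; - $t_k=\mathtt{A^+}$ (respectively $\mathtt{A^-}$) if all order-$k$ principal minors of $B$ are positive (respectively negative); - $t_k=\mathtt{N}$ if all order-$k$ principal minors of $B$ are zero; - $t_k=\mathtt{S^*}$ if $B$ has a positive, a negative and a zero order-$k$ principal minor; - $t_k=\mathtt{S^+}$ (respectively $\mathtt{S^-}$) if $B$ has both a zero and a nonzero order-$k$ principal minor and all nonzero order-$k$ principal minors are positive (respectively negative). A subsequence of $x_1x_2\cdots x_n$ means a block of consecutive terms $x_px_{p+1}\cdots x_q$ with $1\le p\le q\le n$. *)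

theory Defs
  imports
    "Jordan_Normal_Form.Schur_Decomposition"
    "Jordan_Normal_Form.DL_Submatrix"
    "Jordan_Normal_Form.Determinant"
    "HOL-Library.Sublist"
begin

text \<open>Rows and columns are numbered from \<open>0\<close>, so \<open>\<alpha>\<close> ranges over subsets of \<open>{..<n}\<close>.\<close>

definition principal_minor :: "complex mat \<Rightarrow> nat set \<Rightarrow> complex" where
  "principal_minor B \<alpha> = det (submatrix B \<alpha> \<alpha>)"

definition principal_minors :: "complex mat \<Rightarrow> nat \<Rightarrow> complex set" where
  "principal_minors B k = {principal_minor B \<alpha> | \<alpha>. \<alpha> \<subseteq> {..<dim_row B} \<and> card \<alpha> = k}"

datatype sepr_symbol = A_star | A_plus | A_minus | N | S_star | S_plus | S_minus

text \<open>
  The order on \<open>complex\<close> is the one of \<open>HOL-Library.Complex_Order\<close>: \<open>0 < z\<close> means that \<open>z\<close> is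
  real and positive. The last branch is reached exactly in the case of \<open>S\<^sup>-\<close>, since the
  principal minors of a Hermitian matrix are real: see \<open>sepr_term_eq_S_minus_iff\<close>.
\<close>

definition sepr_term :: "complex mat \<Rightarrow> nat \<Rightarrow> sepr_symbol" where
  "sepr_term B k = (let M = principal_minors B k in
     if (\<forall>x\<in>M. x \<noteq> 0) \<and> (\<exists>x\<in>M. x > 0) \<and> (\<exists>x\<in>M. x < 0) then A_star
     else if \<forall>x\<in>M. x > 0 then A_plus
     else if \<forall>x\<in>M. x < 0 then A_minus
     else if \<forall>x\<in>M. x = 0 then N
     else if (\<exists>x\<in>M. x > 0) \<and> (\<exists>x\<in>M. x < 0) \<and> (\<exists>x\<in>M. x = 0) then S_star
     else if (\<exists>x\<in>M. x = 0) \<and> (\<exists>x\<in>M. x \<noteq> 0) \<and> (\<forall>x\<in>M. x \<noteq> 0 \<longrightarrow> x > 0) then S_plus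
     else S_minus)"

text \<open>The term \<open>t\<^sub>k\<close> of the sequence is \<open>sepr B ! (k - 1)\<close>.\<close>

definition sepr :: "complex mat \<Rightarrow> sepr_symbol list" where
  "sepr B = map (sepr_term B) [1..<Suc (dim_row B)]"

lemma principal_minor_Reals:
  assumes B: "B \<in> carrier_mat n n" and herm: "mat_adjoint B = B"
  shows "principal_minor B \<alpha> \<in> \<real>"
proof -
  have entry: "B $$ (j, i) = cnj (B $$ (i, j))" if "i < n" "j < n" for i j
  proof -
    have "B $$ (j, i) = mat_adjoint B $$ (j, i)"
      using herm by simp
    also have "\<dots> = cnj (B $$ (i, j))"
      using B that by (simp add: mat_adjoint_def mat_of_rows_def cols_def)
    finally show ?thesis .
  qed
  interpret cnj_hom: comm_ring_hom cnj
    by unfold_locales auto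
  define S where "S = submatrix B \<alpha> \<alpha>"
  define m where "m = card {i. i < n \<and> i \<in> \<alpha>}"
  have S: "S \<in> carrier_mat m m"
    using B by (auto simp: S_def m_def submatrix_def)
  have pick_less: "pick \<alpha> i < n" if "i < m" for i
    using that pick_le unfolding m_def by blast
  have S_ij: "S $$ (i, j) = B $$ (pick \<alpha> i, pick \<alpha> j)" if "i < m" "j < m" for i j
    using that B by (auto simp: S_def submatrix_def m_def)
  have "transpose_mat S = map_mat cnj S"
  proof (rule eq_matI)
    fix i j assume "i < dim_row (map_mat cnj S)" "j < dim_col (map_mat cnj S)"
    then have ij: "i < m" "j < m"
      using S by auto
    have "S $$ (j, i) = cnj (S $$ (i, j))"
      using entry[OF pick_less[OF ij(1)] pick_less[OF ij(2)]]
      unfolding S_ij[OF ij] S_ij[OF ij(2) ij(1)] .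
    then show "transpose_mat S $$ (i, j) = map_mat cnj S $$ (i, j)"
      using ij S by simp
  qed (use S in auto)
  then have "det S = det (map_mat cnj S)"
    using det_transpose[OF S] by simp
  also have "\<dots> = cnj (det S)"
    by (rule cnj_hom.hom_det)
  finally show ?thesis
    by (simp add: principal_minor_def S_def Reals_cnj_iff)
qed

lemma sepr_term_eq_S_minus_iff:
  assumes "B \<in> carrier_mat n n" "mat_adjoint B = B"
  shows "sepr_term B k = S_minus \<longleftrightarrow>
    (\<exists>x\<in>principal_minors B k. x = 0) \<and> (\<exists>x\<in>principal_minors B k. x \<noteq> 0) \<and>
    (\<forall>x\<in>principal_minors B k. x \<noteq> 0 \<longrightarrow> x < 0)"
proof -
  define M where "M = principal_minors B k"
  have tri: "x < 0 \<or> x = 0 \<or> x > 0" if "x \<in> M" for x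
  proof -
    have "x \<in> \<real>"
      using that principal_minor_Reals[OF assms(1,2)] assms(1)
      by (auto simp: M_def principal_minors_def)
    then show ?thesis
      by (auto simp: less_complex_def complex_is_Real_iff complex_eq_iff)
  qed
  let ?R = "\<lambda>M. (\<exists>x\<in>M. x = 0) \<and> (\<exists>x\<in>M. x \<noteq> 0) \<and> (\<forall>x\<in>M. x \<noteq> (0::complex) \<longrightarrow> x < 0)"
  have "sepr_term B k = S_minus \<longleftrightarrow> ?R M"
  proof
    assume "sepr_term B k = S_minus"
    then show "?R M"
      unfolding sepr_term_def Let_def M_def[symmetric]
      using tri by (smt (verit) sepr_symbol.distinct order_less_irrefl)
  next
    assume R: "?R M"
    then obtain x y where "x \<in> M" "x = 0" "y \<in> M" "y < 0"
      by blast
    moreover have "\<not> z > 0" if "z \<in> M" for z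
      using R that by (metis less_asym)
    ultimately show "sepr_term B k = S_minus"
      unfolding sepr_term_def Let_def M_def[symmetric]
      by (smt (verit) order_less_irrefl)
  qed
  then show ?thesis
    by (simp add: M_def)
qed

end

theory Submission
  imports Defs
begin

text \<open>
  Call the principal minors of order \<open>k\<close>, \<open>k + 1\<close>, \<open>k + 2\<close> of a Hermitian matrix \<open>B\<close> lower, middle
  and upper. If no lower and no upper minor is negative, then the middle minors cannot take both
  signs; this excludes both patterns at once (\<open>hermitian_minors_no_sign_change\<close>).

  Suppose that \<open>B[\<alpha>]\<close> has a positive and \<open>B[\<beta>]\<close> a negative determinant, \<open>\<alpha>\<close> and \<open>\<beta>\<close> of order
  \<open>k + 1\<close>, with \<open>U = \<alpha> - \<beta>\<close> as small as possible, and let \<open>V = \<beta> - \<alpha>\<close>. The tool is the principal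
  pivot transform \<open>P\<close> of \<open>B\<close> at \<open>\<alpha>\<close>: its principal minors \<open>f S\<close> satisfy
  \<open>det B[\<alpha> \<triangle> S] = det B[\<alpha>] * f S\<close>, so \<open>f S\<close> has the sign of the minor of \<open>B\<close> at \<open>\<alpha> \<triangle> S\<close>, and
  \<open>P\<close> is Hermitian up to signs: \<open>P\<^sub>j\<^sub>i\<close> is the conjugate of \<open>P\<^sub>i\<^sub>j\<close> when \<open>i\<close> and \<open>j\<close> lie on the same side
  of \<open>\<alpha>\<close>, and minus the conjugate otherwise. For \<open>i \<in> U\<close> and \<open>j \<in> V\<close>:

  \<^item> \<open>f {i} = P\<^sub>i\<^sub>i\<close> has the sign of a lower minor and \<open>f {j} = P\<^sub>j\<^sub>j\<close> that of an upper one, so \<open>P\<^sub>i\<^sub>i \<ge> 0\<close> and \<open>P\<^sub>j\<^sub>j \<ge> 0\<close>.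

  \<^item> If \<open>f {i, j} = P\<^sub>i\<^sub>i P\<^sub>j\<^sub>j + |P\<^sub>i\<^sub>j|\<^sup>2\<close> were positive, \<open>\<alpha>\<close> could be moved closer to \<open>\<beta>\<close>. So
    \<open>P\<^sub>i\<^sub>j = 0\<close> and \<open>P\<^sub>i\<^sub>i P\<^sub>j\<^sub>j = 0\<close>. In particular \<open>f (S \<union> T) = f S * f T\<close> for \<open>S \<subseteq> U\<close>, \<open>T \<subseteq> V\<close>, and
    since \<open>f (U \<union> V) < 0\<close>, the blocks \<open>P[U]\<close> and \<open>P[V]\<close> are both nonzero.

  \<^item> If some \<open>P\<^sub>i\<^sub>i > 0\<close>, then \<open>P\<close> has zero diagonal on \<open>V\<close>, and \<open>f {i, j, l} = - P\<^sub>i\<^sub>i |P\<^sub>j\<^sub>l|\<^sup>2\<close>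
    has the sign of an upper minor for all \<open>l \<in> V - {j}\<close>; hence \<open>P[V] = 0\<close>, which is impossible. The case \<open>P\<^sub>j\<^sub>j > 0\<close> is the
    same with a lower minor.

  \<^item> So \<open>P\<close> has zero diagonal on \<open>U \<union> V\<close>. With nonzero entries \<open>P\<^sub>i\<^sub>h\<close> in \<open>P[U]\<close> and \<open>P\<^sub>j\<^sub>l\<close> in
    \<open>P[V]\<close> one gets \<open>f {i, h, j, l} = |P\<^sub>i\<^sub>h|\<^sup>2 |P\<^sub>j\<^sub>l|\<^sup>2 > 0\<close>, and again \<open>\<alpha>\<close> could be moved closer to \<open>\<beta>\<close>.
\<close>

section \<open>Principal minors as determinants of full size\<close>

text \<open>
  Replacing the columns outside \<open>S\<close> by unit vectors gives a matrix of full size whose determinant is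
  the principal minor at \<open>S\<close>. In this form identities between principal minors become identities
  between matrix products, without any renumbering of rows.
\<close>

definition col_select :: "'a :: comm_ring_1 mat \<Rightarrow> nat set \<Rightarrow> 'a mat" where
  "col_select A S = mat (dim_row A) (dim_col A)
     (\<lambda>(i, j). if j \<in> S then A $$ (i, j) else of_bool (i = j))"

lemma col_select_carrier [simp]: "A \<in> carrier_mat n m \<Longrightarrow> col_select A S \<in> carrier_mat n m"
  by (simp add: col_select_def)

lemma col_select_index [simp]:
  "A \<in> carrier_mat n m \<Longrightarrow> i < n \<Longrightarrow> j < m \<Longrightarrow>
   col_select A S $$ (i, j) = (if j \<in> S then A $$ (i, j) else of_bool (i = j))"
  by (simp add: col_select_def)

lemma det_permute_rows_cols:
  fixes A :: "'a :: comm_ring_1 mat"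
  assumes A: "A \<in> carrier_mat n n" and p: "p permutes {0..<n}"
  shows "det (mat n n (\<lambda>(i, j). A $$ (p i, p j))) = det A"
proof -
  define T where "T = mat n n (\<lambda>(i, j). transpose_mat A $$ (p i, j))"
  have p_less: "p i < n" if "i < n" for i
    using permutes_in_image[OF p, of i] that by auto
  have T: "T \<in> carrier_mat n n"
    by (simp add: T_def)
  have "mat n n (\<lambda>(i, j). A $$ (p i, p j)) = mat n n (\<lambda>(i, j). transpose_mat T $$ (p i, j))"
    using A p_less by (intro eq_matI) (auto simp: T_def)
  then have "det (mat n n (\<lambda>(i, j). A $$ (p i, p j))) = signof p * det T"
    using det_permute_rows[OF transpose_carrier_mat[THEN iffD2, OF T] p] det_transpose[OF T] by simp
  also have "det T = signof p * det A"
    using det_permute_rows[OF transpose_carrier_mat[THEN iffD2, OF A] p] det_transpose[OF A]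
    by (simp add: T_def)
  finally show ?thesis
    by (simp add: sign_def)
qed

text \<open>
  A simultaneous permutation of rows and columns brings \<open>S\<close> to the front; the unit columns then form
  the right half of a block lower triangular matrix. The enumeration \<open>e\<close> of \<open>S\<close> is arbitrary, so that
  small minors need no case distinction on the order of their indices.
\<close>
lemma det_col_select:
  fixes A :: "'a :: idom mat"
  assumes A: "A \<in> carrier_mat n n" and S: "S \<subseteq> {..<n}" and e: "bij_betw e {..<m} S"
  shows "det (col_select A S) = det (mat m m (\<lambda>(i, j). A $$ (e i, e j)))"
proof -
  have fin: "finite S"
    using S finite_subset by blast
  have m: "card S = m"
    using bij_betw_same_card[OF e] by simp
  have mn: "m \<le> n"
    using m card_mono[OF _ S] by simp
  have "card {m..<n} = card ({..<n} - S)"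
    using card_Diff_subset[OF fin S] m by simp
  then obtain g where g: "bij_betw g {m..<n} ({..<n} - S)"
    using finite_same_card_bij[of "{m..<n}" "{..<n} - S"] by auto
  define p where "p i = (if i < m then e i else if i < n then g i else i)" for i
  have "bij_betw p ({..<m} \<union> {m..<n}) (S \<union> ({..<n} - S))"
  proof (rule bij_betw_combine)
    show "bij_betw p {..<m} S"
      using e by (rule bij_betw_cong[THEN iffD1, rotated]) (simp add: p_def)
    show "bij_betw p {m..<n} ({..<n} - S)"
      using g by (rule bij_betw_cong[THEN iffD1, rotated]) (simp add: p_def)
  qed auto
  moreover have "{..<m} \<union> {m..<n} = {0..<n}" "S \<union> ({..<n} - S) = {0..<n}"
    using mn S by auto
  ultimately have bij: "bij_betw p {0..<n} {0..<n}"
    by simp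
  then have p: "p permutes {0..<n}"
    by (rule bij_imp_permutes) (use mn in \<open>auto simp: p_def\<close>)
  have p_less: "p i < n" if "i < n" for i
    using permutes_in_image[OF p, of i] that by auto
  have p_S: "p i \<in> S \<longleftrightarrow> i < m" if "i < n" for i
    using bij_betw_apply[OF e, of i] bij_betw_apply[OF g, of i] that by (auto simp: p_def)
  have p_eq: "p i = p j \<longleftrightarrow> i = j" if "i < n" "j < n" for i j
    using bij that by (auto simp: bij_betw_def inj_on_def)
  let ?A4 = "1\<^sub>m (n - m) :: 'a mat"
  let ?A3 = "mat (n - m) m (\<lambda>(i, j). A $$ (p (i + m), p j))"
  let ?A1 = "mat m m (\<lambda>(i, j). A $$ (e i, e j))"
  have "det (col_select A S) = det (mat n n (\<lambda>(i, j). col_select A S $$ (p i, p j)))"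
    using det_permute_rows_cols[OF _ p, of "col_select A S"] A by simp
  also have "mat n n (\<lambda>(i, j). col_select A S $$ (p i, p j)) =
      four_block_mat ?A1 (0\<^sub>m m (n - m)) ?A3 ?A4"
  proof (rule eq_matI)
    fix i j
    assume "i < dim_row (four_block_mat ?A1 (0\<^sub>m m (n - m)) ?A3 ?A4)"
      "j < dim_col (four_block_mat ?A1 (0\<^sub>m m (n - m)) ?A3 ?A4)"
    then have ij: "i < n" "j < n"
      using mn by auto
    have "col_select A S $$ (p i, p j) = (if j < m then A $$ (p i, p j) else of_bool (i = j))"
      using A ij p_less p_S p_eq by simp
    then show "mat n n (\<lambda>(i, j). col_select A S $$ (p i, p j)) $$ (i, j) =
        four_block_mat ?A1 (0\<^sub>m m (n - m)) ?A3 ?A4 $$ (i, j)"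
      using ij by (auto simp: p_def)
  qed (use mn in auto)
  also have "det \<dots> = det ?A1 * det ?A4"
    by (rule det_four_block_mat_upper_right_zero) auto
  finally show ?thesis
    by simp
qed

lemma det_col_select_eq_det_submatrix:
  fixes A :: "'a :: idom mat"
  assumes A: "A \<in> carrier_mat n n" and S: "S \<subseteq> {..<n}"
  shows "det (col_select A S) = det (submatrix A S S)"
proof -
  have fin: "finite S"
    using S finite_subset by blast
  have [simp]: "{i. i < n \<and> i \<in> S} = S"
    using S by auto
  have "bij_betw (pick S) {..<card S} S"
  proof (rule bij_betw_imageI)
    show "inj_on (pick S) {..<card S}"
      by (rule inj_onI, metis card_pick lessThan_iff)
    then show "pick S ` {..<card S} = S"
      by (intro card_subset_eq[OF fin]) (auto simp: card_image pick_in_set_le)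
  qed
  from det_col_select[OF A S this] A show ?thesis
    by (simp add: submatrix_def)
qed

lemma det_col_select_singleton:
  fixes A :: "'a :: idom mat"
  assumes A: "A \<in> carrier_mat n n" and i: "i < n"
  shows "det (col_select A {i}) = A $$ (i, i)"
  using det_col_select[OF A, of "{i}" "\<lambda>_. i" 1] i
  by (simp add: bij_betw_def lessThan_Suc det_single)

lemma det_col_select_doubleton:
  fixes A :: "'a :: idom mat"
  assumes A: "A \<in> carrier_mat n n" and ij: "i < n" "j < n" "i \<noteq> j"
  shows "det (col_select A {i, j}) = A $$ (i, i) * A $$ (j, j) - A $$ (i, j) * A $$ (j, i)"
proof -
  define e where "e x = (if x = 0 then i else j)" for x :: nat
  define D where "D = mat 2 2 (\<lambda>(x, y). A $$ (e x, e y))"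
  have "bij_betw e {..<2} {i, j}"
    using ij by (auto simp: bij_betw_def e_def inj_on_def less_2_cases_iff image_iff)
  then have "det (col_select A {i, j}) = det D"
    using det_col_select[OF A, of "{i, j}" e 2] ij by (simp add: D_def)
  also have "det D = (\<Sum>x<2. D $$ (x, 0) * cofactor D x 0)"
    by (rule laplace_expansion_column) (auto simp: D_def)
  also have "\<dots> = D $$ (0, 0) * D $$ (1, 1) - D $$ (1, 0) * D $$ (0, 1)"
    by (simp add: numeral_2_eq_2 cofactor_def mat_delete_def D_def det_single)
  finally show ?thesis
    by (simp add: D_def e_def mult.commute)
qed


lemma mult_mat_index:
  assumes "A \<in> carrier_mat n m" "C \<in> carrier_mat m l" "i < n" "j < l"
  shows "(A * C) $$ (i, j) = (\<Sum>k<m. A $$ (i, k) * C $$ (k, j))"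
  using assms by (simp add: scalar_prod_def lessThan_atLeast0)

lemma mult_col_select_index:
  assumes M: "M \<in> carrier_mat n n" and A: "A \<in> carrier_mat n n" and ij: "i < n" "j < n"
  shows "(M * col_select A S) $$ (i, j) = (if j \<in> S then (M * A) $$ (i, j) else M $$ (i, j))"
proof -
  have "(M * col_select A S) $$ (i, j) = (\<Sum>l<n. M $$ (i, l) * col_select A S $$ (l, j))"
    using M A ij by (intro mult_mat_index) auto
  also have "\<dots> = (if j \<in> S then \<Sum>l<n. M $$ (i, l) * A $$ (l, j)
      else \<Sum>l<n. M $$ (i, l) * of_bool (l = j))"
    using A ij by simp
  also have "(\<Sum>l<n. M $$ (i, l) * of_bool (l = j)) = M $$ (i, j)"
    using ij by simp
  also have "(\<Sum>l<n. M $$ (i, l) * A $$ (l, j)) = (M * A) $$ (i, j)"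
    using M A ij by (intro mult_mat_index[symmetric]) auto
  finally show ?thesis .
qed

text \<open>
  The multiplicativity of block triangular determinants: if the block with rows \<open>S\<close> and columns \<open>T\<close>
  vanishes, multiplying by \<open>col_select A S\<close> from the left fixes the columns of \<open>A\<close> in \<open>T\<close>.
\<close>
lemma det_col_select_Un:
  fixes A :: "'a :: comm_ring_1 mat"
  assumes A: "A \<in> carrier_mat n n" and ST: "S \<inter> T = {}"
    and zero: "\<And>i j. i \<in> S \<Longrightarrow> j \<in> T \<Longrightarrow> A $$ (i, j) = 0"
  shows "det (col_select A (S \<union> T)) = det (col_select A S) * det (col_select A T)"
proof -
  have "col_select A (S \<union> T) = col_select A S * col_select A T"
  proof (rule eq_matI)
    fix i j
    assume "i < dim_row (col_select A S * col_select A T)"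
      "j < dim_col (col_select A S * col_select A T)"
    with A have ij: "i < n" "j < n"
      by (auto simp: col_select_def)
    have "(col_select A S * A) $$ (i, j) = A $$ (i, j)" if "j \<in> T"
    proof -
      have "(col_select A S * A) $$ (i, j) = (\<Sum>l<n. col_select A S $$ (i, l) * A $$ (l, j))"
        using A ij by (intro mult_mat_index) auto
      also have "\<dots> = (\<Sum>l<n. of_bool (i = l) * A $$ (l, j))"
        using A ij zero that by (intro sum.cong) auto
      finally show ?thesis
        using ij by simp
    qed
    then show "col_select A (S \<union> T) $$ (i, j) = (col_select A S * col_select A T) $$ (i, j)"
      using mult_col_select_index[of "col_select A S" n A i j T] ij A ST by auto
  qed (use A in \<open>auto simp: col_select_def\<close>)
  then show ?thesis
    using A by (simp add: det_mult[of _ n])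
qed

section \<open>The principal pivot transform\<close>

text \<open>
  The matrix \<open>P\<close> with \<open>col_select B \<alpha> * P = col_select B (- \<alpha>)\<close> is, up to signs of off-diagonal
  blocks, the principal pivot transform of \<open>B\<close> at \<open>\<alpha>\<close>. Left multiplication by \<open>col_select B \<alpha>\<close>
  sends the \<open>j\<close>-th unit vector to the \<open>j\<close>-th column of \<open>B\<close> if \<open>j \<in> \<alpha>\<close> and to itself otherwise, and
  it sends the \<open>j\<close>-th column of \<open>P\<close> to the other one of these two vectors. So selecting the columns
  of \<open>P\<close> on a set toggles the membership in \<open>\<alpha>\<close> of its elements.
\<close>
lemma det_col_select_pivot:
  fixes B :: "'a :: comm_ring_1 mat"
  assumes B: "B \<in> carrier_mat n n" and P: "P \<in> carrier_mat n n"
    and BP: "col_select B \<alpha> * P = col_select B (- \<alpha>)"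
  shows "det (col_select B \<gamma>) = det (col_select B \<alpha>) * det (col_select P (sym_diff \<alpha> \<gamma>))"
proof -
  have "col_select B \<gamma> = col_select B \<alpha> * col_select P (sym_diff \<alpha> \<gamma>)"
  proof (rule eq_matI)
    fix i j
    assume "i < dim_row (col_select B \<alpha> * col_select P (sym_diff \<alpha> \<gamma>))"
      "j < dim_col (col_select B \<alpha> * col_select P (sym_diff \<alpha> \<gamma>))"
    with B P have ij: "i < n" "j < n"
      by (auto simp: col_select_def)
    show "col_select B \<gamma> $$ (i, j) = (col_select B \<alpha> * col_select P (sym_diff \<alpha> \<gamma>)) $$ (i, j)"
      using mult_col_select_index[of "col_select B \<alpha>" n P i j "sym_diff \<alpha> \<gamma>"] B P ij
      by (auto simp: BP)
  qed (use B P in \<open>auto simp: col_select_def\<close>)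
  then show ?thesis
    using B P by (simp add: det_mult[of _ n])
qed

definition conj_transpose :: "complex mat \<Rightarrow> complex mat" where
  "conj_transpose A = transpose_mat (map_mat cnj A)"

lemma conj_transpose_carrier [simp]:
  "A \<in> carrier_mat n m \<Longrightarrow> conj_transpose A \<in> carrier_mat m n"
  by (simp add: conj_transpose_def)

lemma conj_transpose_index [simp]:
  "A \<in> carrier_mat n m \<Longrightarrow> i < m \<Longrightarrow> j < n \<Longrightarrow> conj_transpose A $$ (i, j) = cnj (A $$ (j, i))"
  by (simp add: conj_transpose_def)

lemma conj_transpose_mult:
  assumes "A \<in> carrier_mat n m" "C \<in> carrier_mat m l"
  shows "conj_transpose (A * C) = conj_transpose C * conj_transpose A"
  using assms by (intro eq_matI) (auto simp: conj_transpose_def scalar_prod_def mult.commute)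

lemma conj_transpose_one [simp]: "conj_transpose (1\<^sub>m n) = 1\<^sub>m n"
  by (rule eq_matI) (auto simp: conj_transpose_def)

text \<open>
  The symmetry of \<open>P\<close> says that \<open>P J\<close> is Hermitian, where \<open>J\<close> is the diagonal matrix with entries \<open>1\<close>
  on \<open>\<alpha>\<close> and \<open>-1\<close> off \<open>\<alpha>\<close>. With \<open>M = col_select B \<alpha>\<close> and \<open>K = col_select B (- \<alpha>) = M P\<close>, a computation
  of entries shows that \<open>M J K\<^sup>* = K J M\<^sup>*\<close>, that is, \<open>M (J P\<^sup>*) M\<^sup>* = M (P J) M\<^sup>*\<close>; cancelling the
  invertible outer factors leaves \<open>J P\<^sup>* = P J\<close>.
\<close>
lemma hermitian_pivot_exists:
  fixes B :: "complex mat"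
  assumes B: "B \<in> carrier_mat n n"
    and herm: "\<And>i j. i < n \<Longrightarrow> j < n \<Longrightarrow> B $$ (j, i) = cnj (B $$ (i, j))"
    and nz: "det (col_select B \<alpha>) \<noteq> 0"
  obtains P where "P \<in> carrier_mat n n" "col_select B \<alpha> * P = col_select B (- \<alpha>)"
    "\<And>i j. i < n \<Longrightarrow> j < n \<Longrightarrow>
       P $$ (j, i) = (if i \<in> \<alpha> \<longleftrightarrow> j \<in> \<alpha> then cnj (P $$ (i, j)) else - cnj (P $$ (i, j)))"
proof -
  define M where "M = col_select B \<alpha>"
  define K where "K = col_select B (- \<alpha>)"
  have M: "M \<in> carrier_mat n n" and K: "K \<in> carrier_mat n n"
    using B by (auto simp: M_def K_def)
  obtain R where R: "R \<in> carrier_mat n n" "R * M = 1\<^sub>m n" "M * R = 1\<^sub>m n"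
    using det_non_zero_imp_unit[OF M, of "()"] nz
    by (auto simp: M_def Units_def ring_mat_def)
  define P where "P = R * K"
  have P: "P \<in> carrier_mat n n"
    using R K by (simp add: P_def)
  have MP: "M * P = K"
    using M R K unfolding P_def by (simp add: assoc_mult_mat[of M n n R n K n, symmetric])
  define \<epsilon> :: "nat \<Rightarrow> complex" where "\<epsilon> i = (if i \<in> \<alpha> then 1 else - 1)" for i
  define J where "J = mat n n (\<lambda>(i, j). if i = j then \<epsilon> i else 0)"
  have J: "J \<in> carrier_mat n n"
    by (simp add: J_def)
  have J_left: "(J * X) $$ (i, j) = \<epsilon> i * X $$ (i, j)"
    if "X \<in> carrier_mat n n" "i < n" "j < n" for X i j
    using that by (simp add: J_def scalar_prod_def if_distrib[of "\<lambda>x. x * _"] cong: if_cong)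
  have J_right: "(X * J) $$ (i, j) = X $$ (i, j) * \<epsilon> j"
    if "X \<in> carrier_mat n n" "i < n" "j < n" for X i j
    using that by (simp add: J_def scalar_prod_def if_distrib[of "\<lambda>x. _ * x"] cong: if_cong)
  have prod_index:
    "(X * (J * conj_transpose Y)) $$ (i, j) = (\<Sum>l<n. X $$ (i, l) * (\<epsilon> l * cnj (Y $$ (j, l))))"
    if "X \<in> carrier_mat n n" "Y \<in> carrier_mat n n" "i < n" "j < n" for X Y i j
  proof -
    have "(X * (J * conj_transpose Y)) $$ (i, j) =
        (\<Sum>l<n. X $$ (i, l) * (J * conj_transpose Y) $$ (l, j))"
      using that J by (intro mult_mat_index) auto
    then show ?thesis
      using that J_left[OF conj_transpose_carrier[OF that(2)]] by simp
  qed
  have "M * (J * conj_transpose K) = K * (J * conj_transpose M)"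
  proof (rule eq_matI)
    fix i j
    assume "i < dim_row (K * (J * conj_transpose M))" "j < dim_col (K * (J * conj_transpose M))"
    then have ij: "i < n" "j < n"
      using K M J by (auto simp: conj_transpose_def)
    have hB: "cnj (B $$ (j, i)) = B $$ (i, j)"
      using herm[OF ij] by simp
    have "(M * (J * conj_transpose K)) $$ (i, j) =
        (\<Sum>l<n. (if l = j then of_bool (l \<in> \<alpha>) * B $$ (i, j) else 0)
               - (if l = i then of_bool (l \<notin> \<alpha>) * B $$ (i, j) else 0))"
      unfolding prod_index[OF M K ij]
      using ij B hB by (intro sum.cong) (auto simp: M_def K_def \<epsilon>_def)
    also have "\<dots> = of_bool (j \<in> \<alpha>) * B $$ (i, j) - of_bool (i \<notin> \<alpha>) * B $$ (i, j)"
      using ij by (simp add: sum_subtractf)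
    also have "\<dots> = of_bool (i \<in> \<alpha>) * B $$ (i, j) - of_bool (j \<notin> \<alpha>) * B $$ (i, j)"
      by (cases "i \<in> \<alpha>"; cases "j \<in> \<alpha>"; simp)
    also have "\<dots> =
        (\<Sum>l<n. (if l = i then of_bool (l \<in> \<alpha>) * B $$ (i, j) else 0)
               - (if l = j then of_bool (l \<notin> \<alpha>) * B $$ (i, j) else 0))"
      using ij by (simp add: sum_subtractf)
    also have "\<dots> = (K * (J * conj_transpose M)) $$ (i, j)"
      unfolding prod_index[OF K M ij]
      using ij B hB by (intro sum.cong) (auto simp: M_def K_def \<epsilon>_def)
    finally show "(M * (J * conj_transpose K)) $$ (i, j) = (K * (J * conj_transpose M)) $$ (i, j)" .
  qed (use M K J in \<open>auto simp: conj_transpose_def\<close>)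
  moreover have "conj_transpose K = conj_transpose P * conj_transpose M"
    using conj_transpose_mult[OF M P] by (simp add: MP)
  ultimately have eq: "M * (J * (conj_transpose P * conj_transpose M)) = M * P * (J * conj_transpose M)"
    by (simp add: MP)
  let ?P = "conj_transpose P" and ?M = "conj_transpose M" and ?R = "conj_transpose R"
  have adj: "?P \<in> carrier_mat n n" "?M \<in> carrier_mat n n" "?R \<in> carrier_mat n n"
    using P M R by auto
  have MR: "?M * ?R = 1\<^sub>m n"
    using conj_transpose_mult[OF R(1) M] R(2) by simp
  have cancel: "R * (M * X) * ?R = X * ?R" if "X \<in> carrier_mat n n" for X
    using that R M by (simp add: assoc_mult_mat[of R n n M n X n, symmetric])
  have "R * (M * (J * (?P * ?M))) * ?R = R * (M * (P * (J * ?M))) * ?R"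
    using eq M P J adj by (simp add: assoc_mult_mat[of M n n P n "J * ?M" n])
  then have "J * (?P * ?M) * ?R = P * (J * ?M) * ?R"
    using cancel M P J adj by simp
  then have JP: "J * ?P = P * J"
    using J P adj MR by (simp add: assoc_mult_mat[of _ n n _ n _ n])
  have "P $$ (j, i) = (if i \<in> \<alpha> \<longleftrightarrow> j \<in> \<alpha> then cnj (P $$ (i, j)) else - cnj (P $$ (i, j)))"
    if ij: "i < n" "j < n" for i j
  proof -
    have "\<epsilon> j * cnj (P $$ (i, j)) = P $$ (j, i) * \<epsilon> i"
      using arg_cong[OF JP, of "\<lambda>X. X $$ (j, i)"] J_left[OF adj(1) ij(2,1)] J_right[OF P ij(2,1)] P ij
      by simp
    then show ?thesis
      by (auto simp: \<epsilon>_def split: if_splits)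
  qed
  with P MP show ?thesis
    unfolding M_def K_def by (rule that)
qed


section \<open>Signs of the minors of three consecutive orders\<close>

text \<open>
  For a fixed \<open>\<beta>\<close> with negative minor, induction on \<open>card (\<alpha> - \<beta>)\<close> replaces the choice of a closest
  \<open>\<alpha>\<close> with positive minor: the induction hypothesis says that no set of the same order closer to \<open>\<beta>\<close>
  has a positive minor.
\<close>
lemma hermitian_minors_no_sign_change:
  fixes B :: "complex mat"
  assumes B: "B \<in> carrier_mat n n"
    and herm: "\<And>i j. i < n \<Longrightarrow> j < n \<Longrightarrow> B $$ (j, i) = cnj (B $$ (i, j))"
    and lower: "\<And>\<gamma>. \<gamma> \<subseteq> {..<n} \<Longrightarrow> card \<gamma> = k \<Longrightarrow> 0 \<le> det (col_select B \<gamma>)"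
    and upper: "\<And>\<gamma>. \<gamma> \<subseteq> {..<n} \<Longrightarrow> card \<gamma> = k + 2 \<Longrightarrow> 0 \<le> det (col_select B \<gamma>)"
    and \<beta>: "\<beta> \<subseteq> {..<n}" "card \<beta> = k + 1" "det (col_select B \<beta>) < 0"
    and \<alpha>: "\<alpha> \<subseteq> {..<n}" "card \<alpha> = k + 1"
  shows "\<not> 0 < det (col_select B \<alpha>)"
  using \<alpha>
proof (induction "card (\<alpha> - \<beta>)" arbitrary: \<alpha> rule: less_induct)
  case less
  note \<alpha> = less.prems
  show ?case
  proof
    assume pos: "0 < det (col_select B \<alpha>)"
    have fin: "finite \<alpha>" "finite \<beta>"
      using \<alpha> \<beta> finite_subset by blast+
    define a where "a = Re (det (col_select B \<alpha>))"
    have a: "det (col_select B \<alpha>) = of_real a" "a > 0"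
      using pos by (auto simp: a_def less_complex_def complex_eq_iff)
    have "det (col_select B \<alpha>) \<noteq> 0"
      using pos by auto
    then obtain P where P: "P \<in> carrier_mat n n"
      and BP: "col_select B \<alpha> * P = col_select B (- \<alpha>)"
      and P_sym: "\<And>i j. i < n \<Longrightarrow> j < n \<Longrightarrow>
        P $$ (j, i) = (if i \<in> \<alpha> \<longleftrightarrow> j \<in> \<alpha> then cnj (P $$ (i, j)) else - cnj (P $$ (i, j)))"
      using hermitian_pivot_exists[OF B herm] by metis
    define f where "f S = det (col_select P S)" for S
    have minor: "det (col_select B (sym_diff \<alpha> S)) = of_real a * f S" for S
    proof -
      have "sym_diff \<alpha> (sym_diff \<alpha> S) = S"
        by auto
      then show ?thesis
        using det_col_select_pivot[OF B P BP, of "sym_diff \<alpha> S"] a by (simp add: f_def)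
    qed
    have sgn: "0 \<le> f S \<longleftrightarrow> 0 \<le> det (col_select B (sym_diff \<alpha> S))"
      "0 < f S \<longleftrightarrow> 0 < det (col_select B (sym_diff \<alpha> S))" for S
      using a(2) unfolding minor
      by (auto simp: less_eq_complex_def less_complex_def zero_le_mult_iff zero_less_mult_iff)
    define U where "U = \<alpha> - \<beta>"
    define V where "V = \<beta> - \<alpha>"
    have UV: "U \<subseteq> \<alpha>" "V \<inter> \<alpha> = {}" "U \<inter> V = {}" "finite U" "finite V"
      using fin by (auto simp: U_def V_def)
    have U: "i < n" "i \<in> \<alpha>" if "i \<in> U" for i
      using that \<alpha> by (auto simp: U_def)
    have V: "j < n" "j \<notin> \<alpha>" if "j \<in> V" for j
      using that \<beta> by (auto simp: V_def)

    have exchange: "sym_diff \<alpha> (S \<union> T) = (\<alpha> - S) \<union> T" "(\<alpha> - S) \<union> T \<subseteq> {..<n}"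
      "card ((\<alpha> - S) \<union> T) + card S = k + 1 + card T"
      if "S \<subseteq> U" "T \<subseteq> V" for S T
    proof -
      show "sym_diff \<alpha> (S \<union> T) = (\<alpha> - S) \<union> T" "(\<alpha> - S) \<union> T \<subseteq> {..<n}"
        using that UV \<alpha> V by auto
      have "card ((\<alpha> - S) \<union> T) = card (\<alpha> - S) + card T"
        using that UV fin by (intro card_Un_disjoint) (auto intro: finite_subset)
      moreover have "card (\<alpha> - S) + card S = card \<alpha>"
        using that UV fin
        by (metis card_Diff_subset card_mono finite_subset le_add_diff_inverse2 subset_trans)
      ultimately show "card ((\<alpha> - S) \<union> T) + card S = k + 1 + card T"
        using \<alpha>(2) by simp
    qed
    \<comment> \<open>Sets with one more or one fewer element than \<open>\<alpha>\<close> fall under the sign hypotheses.\<close>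
    have f_nonneg: "0 \<le> f (S \<union> T)"
      if "S \<subseteq> U" "T \<subseteq> V" "card T = card S + 1 \<or> card S = card T + 1" for S T
    proof -
      have "card ((\<alpha> - S) \<union> T) = k \<or> card ((\<alpha> - S) \<union> T) = k + 2"
        using exchange(3)[OF that(1,2)] that(3) by auto
      then show ?thesis
        unfolding sgn exchange(1)[OF that(1,2)]
        using exchange(2)[OF that(1,2)] lower upper by blast
    qed
    \<comment> \<open>Exchanging equally many elements leads to a set closer to \<open>\<beta>\<close>, to which the induction hypothesis applies.\<close>
    have f_not_pos: "\<not> 0 < f (S \<union> T)"
      if "S \<subseteq> U" "T \<subseteq> V" "card T = card S" "S \<noteq> {}" for S T
    proof -
      have "card ((\<alpha> - S) \<union> T) = k + 1"
        using exchange(3)[OF that(1,2)] that(3) by simp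
      moreover have "((\<alpha> - S) \<union> T) - \<beta> \<subset> \<alpha> - \<beta>"
        using that by (auto simp: U_def V_def)
      then have "card (((\<alpha> - S) \<union> T) - \<beta>) < card (\<alpha> - \<beta>)"
        using fin by (intro psubset_card_mono) auto
      ultimately show ?thesis
        unfolding sgn exchange(1)[OF that(1,2)]
        using exchange(2)[OF that(1,2)] less.hyps by blast
    qed

    have diag: "0 \<le> P $$ (i, i)" if "i \<in> U \<union> V" for i
      using that f_nonneg[of "{i}" "{}"] f_nonneg[of "{}" "{i}"] U V
      by (auto simp: f_def det_col_select_singleton[OF P])
    have diag_real: "\<exists>p\<ge>0. P $$ (i, i) = of_real p" if "i \<in> U \<union> V" for i
      using diag[OF that] by (intro exI[of _ "Re (P $$ (i, i))"])
        (auto simp: less_eq_complex_def complex_eq_iff)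
    have cross: "P $$ (i, j) = 0" "P $$ (j, i) = 0" "P $$ (i, i) = 0 \<or> P $$ (j, j) = 0"
      if UV_ij: "i \<in> U" "j \<in> V" for i j
    proof -
      have ij: "i < n" "j < n" "i \<noteq> j" "i \<in> \<alpha>" "j \<notin> \<alpha>"
        using U V that by auto
      have "f {i, j} = P $$ (i, i) * P $$ (j, j) + of_real ((cmod (P $$ (i, j)))\<^sup>2)"
        using P_sym[of i j] ij
        by (simp add: f_def det_col_select_doubleton[OF P] complex_norm_square del: of_real_power)
      moreover have "\<not> 0 < f {i, j}"
        using f_not_pos[of "{i}" "{j}"] that by (simp add: insert_commute)
      moreover obtain p where "P $$ (i, i) = of_real p" "p \<ge> 0"
        using diag_real[of i] UV_ij by blast
      moreover obtain q where "P $$ (j, j) = of_real q" "q \<ge> 0"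
        using diag_real[of j] UV_ij by blast
      ultimately have pq: "\<not> 0 < p * q + (cmod (P $$ (i, j)))\<^sup>2"
        "P $$ (i, i) = of_real p" "P $$ (j, j) = of_real q" "p * q \<ge> 0"
        by (auto simp: less_complex_def)
      then have "p * q = 0" "(cmod (P $$ (i, j)))\<^sup>2 = 0"
        using zero_le_power2[of "cmod (P $$ (i, j))"] by linarith+
      with pq(2,3) show "P $$ (i, j) = 0" "P $$ (j, i) = 0" "P $$ (i, i) = 0 \<or> P $$ (j, j) = 0"
        using P_sym[of i j] ij by auto
    qed
    have f_Un: "f (S \<union> T) = f S * f T" if "S \<subseteq> U" "T \<subseteq> V" for S T
      unfolding f_def
      using that UV cross by (intro det_col_select_Un[OF P]) blast+
    have f_pair: "f {i, j} = - of_real ((cmod (P $$ (i, j)))\<^sup>2)"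
      if "i \<in> W" "j \<in> W" "W = U \<or> W = V" "P $$ (i, i) = 0" "i \<noteq> j" for i j W
    proof -
      have ij: "i < n" "j < n" "i \<in> \<alpha> \<longleftrightarrow> j \<in> \<alpha>"
        using U V that by auto
      then show ?thesis
        using P_sym[of i j] that
          by (simp add: f_def det_col_select_doubleton[OF P] complex_norm_square del: of_real_power)
    qed

    \<comment> \<open>The blocks of \<open>P\<close> at \<open>U\<close> and at \<open>V\<close> are both nonzero.\<close>
    have "sym_diff \<alpha> (U \<union> V) = \<beta>"
      by (auto simp: U_def V_def)
    then have "f (U \<union> V) \<noteq> 0"
      using minor[of "U \<union> V"] \<beta>(3) by auto
    then have fUV: "f U \<noteq> 0" "f V \<noteq> 0"
      using f_Un by auto
    have "U \<noteq> {}"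
    proof
      assume "U = {}"
      then have "\<alpha> \<subseteq> \<beta>"
        by (auto simp: U_def)
      then have "\<alpha> = \<beta>"
        using card_subset_eq[OF fin(2)] \<alpha> \<beta> by simp
      then show False
        using pos \<beta>(3) by auto
    qed
    moreover have "card V = card U"
      using fin \<alpha>(2) \<beta>(2) unfolding U_def V_def
      by (metis card_Diff_subset_Int finite_Int inf_commute)
    ultimately have "V \<noteq> {}"
      using UV by auto

    have nonzero_entry: "\<exists>i\<in>W. \<exists>j\<in>W. P $$ (i, j) \<noteq> 0"
      if "f W \<noteq> 0" "W \<noteq> {}" "W = U \<or> W = V" for W
    proof (rule ccontr)
      assume zero: "\<not> ?thesis"
      from \<open>W \<noteq> {}\<close> obtain i where i: "i \<in> W"
        by blast
      then have "i < n"
        using that(3) U V by auto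
      have "f ({i} \<union> (W - {i})) = f {i} * f (W - {i})"
        unfolding f_def using zero i by (intro det_col_select_Un[OF P]) auto
      also have "f {i} = 0"
        using zero i \<open>i < n\<close> by (simp add: f_def det_col_select_singleton[OF P])
      finally show False
        using that(1) i by (simp add: insert_absorb)
    qed

    \<comment> \<open>A positive diagonal entry on one side would force the block on the other side to vanish.\<close>
    have diag_zero: "P $$ (i, i) = 0"
      if i: "i \<in> W" and W: "W = U \<and> X = V \<or> W = V \<and> X = U" for i W X
    proof (rule ccontr)
      assume nz: "P $$ (i, i) \<noteq> 0"
      have X_diag: "P $$ (j, j) = 0" if "j \<in> X" for j
        using cross(3)[of i j] cross(3)[of j i] nz i W that by auto
      obtain j j' where j: "j \<in> X" "j' \<in> X" "P $$ (j, j') \<noteq> 0"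
        using nonzero_entry[of X] W fUV \<open>U \<noteq> {}\<close> \<open>V \<noteq> {}\<close> by auto
      then have "j \<noteq> j'"
        using X_diag by auto
      have "f {i} = P $$ (i, i)"
        using i W U V by (auto simp: f_def det_col_select_singleton[OF P])
      moreover have "0 \<le> f {i} * f {j, j'}"
      proof (cases "W = U \<and> X = V")
        case True
        then show ?thesis
          using f_nonneg[of "{i}" "{j, j'}"] f_Un[of "{i}" "{j, j'}"] i j \<open>j \<noteq> j'\<close> by auto
      next
        case False
        then have "W = V" "X = U"
          using W by auto
        then show ?thesis
          using f_nonneg[of "{j, j'}" "{i}"] f_Un[of "{j, j'}" "{i}"] i j \<open>j \<noteq> j'\<close>
          by (auto simp: mult.commute)
      qed
      moreover have "f {j, j'} = - of_real ((cmod (P $$ (j, j')))\<^sup>2)"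
        using f_pair[of j X j'] X_diag j \<open>j \<noteq> j'\<close> W by auto
      moreover obtain p where "P $$ (i, i) = of_real p" "p > 0"
        using diag_real[of i] nz i W by (metis Un_iff of_real_0 order_le_less)
      ultimately have "p * (cmod (P $$ (j, j')))\<^sup>2 \<le> 0" "p > 0"
        by (auto simp: less_eq_complex_def)
      then show False
        using j(3) by (simp add: mult_le_0_iff)
    qed

    \<comment> \<open>Exchanging two elements of \<open>U\<close> for two of \<open>V\<close> now yields a positive minor.\<close>
    obtain i i' where i: "i \<in> U" "i' \<in> U" "P $$ (i, i') \<noteq> 0"
      using nonzero_entry fUV \<open>U \<noteq> {}\<close> by blast
    obtain j j' where j: "j \<in> V" "j' \<in> V" "P $$ (j, j') \<noteq> 0"
      using nonzero_entry fUV \<open>V \<noteq> {}\<close> by blast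
    have d: "P $$ (i, i) = 0" "P $$ (j, j) = 0"
      using diag_zero i j by blast+
    then have ne: "i \<noteq> i'" "j \<noteq> j'"
      using i j by auto
    have "f ({i, i'} \<union> {j, j'}) = f {i, i'} * f {j, j'}"
      using i j by (intro f_Un) auto
    also have "\<dots> = of_real ((cmod (P $$ (i, i')))\<^sup>2 * (cmod (P $$ (j, j')))\<^sup>2)"
      using f_pair[of i U i'] f_pair[of j V j'] i j d ne by simp
    finally have "0 < f ({i, i'} \<union> {j, j'})"
      using i j by (simp add: less_complex_def)
    then show False
      using f_not_pos[of "{i, i'}" "{j, j'}"] i j ne by simp
  qed
qed

section \<open>The symbols of the sepr-sequence\<close>

lemma hermitian_index:
  fixes B :: "complex mat"
  assumes B: "B \<in> carrier_mat n n" and herm: "mat_adjoint B = B" and ij: "i < n" "j < n"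
  shows "B $$ (j, i) = cnj (B $$ (i, j))"
proof -
  have "B $$ (j, i) = mat_adjoint B $$ (j, i)"
    using herm by simp
  also have "\<dots> = cnj (B $$ (i, j))"
    using B ij by (simp add: mat_adjoint_def mat_of_rows_def cols_def)
  finally show ?thesis .
qed

lemma sepr_term_plus_nonneg:
  assumes "sepr_term B k \<in> {A_plus, S_plus}" "x \<in> principal_minors B k"
  shows "0 \<le> x"
  using assms by (fastforce simp: sepr_term_def Let_def split: if_splits)

lemma sepr_term_S_starD:
  assumes "sepr_term B k = S_star"
  shows "\<exists>x\<in>principal_minors B k. 0 < x" "\<exists>x\<in>principal_minors B k. x < 0"
  using assms by (auto simp: sepr_term_def Let_def split: if_splits)

lemma sepr_sublistE:
  assumes "sublist [s, t, u] (sepr B)"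
  obtains k where "sepr_term B k = s" "sepr_term B (k + 1) = t" "sepr_term B (k + 2) = u"
proof -
  from assms obtain ps ss where eq: "sepr B = ps @ [s, t, u] @ ss"
    by (auto simp: sublist_def)
  define k where "k = Suc (length ps)"
  have len: "length ps + 3 \<le> dim_row B"
    using arg_cong[OF eq, of length] by (simp add: sepr_def del: upt_Suc)
  have sepr_nth: "sepr_term B (k + i) = [s, t, u] ! i" if "i < 3" for i
  proof -
    have "sepr B ! (length ps + i) = sepr_term B (k + i)"
      using that len by (simp add: sepr_def k_def del: upt_Suc)
    moreover have "sepr B ! (length ps + i) = [s, t, u] ! i"
      using that unfolding eq by (auto simp: nth_append numeral_3_eq_3 less_Suc_eq)
    ultimately show ?thesis
      by simp
  qed
  show ?thesis
    using that[of k] sepr_nth[of 0] sepr_nth[of 1] sepr_nth[of 2] by simp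
qed

theorem theorem4p3:
  fixes B :: "complex mat" and n :: nat
  assumes "B \<in> carrier_mat n n" and "mat_adjoint B = B"
  shows "\<not> sublist [A_plus, S_star, S_plus] (sepr B) \<and>
         \<not> sublist [S_plus, S_star, S_plus] (sepr B)"
proof -
  have "\<not> sublist [s, S_star, S_plus] (sepr B)" if s: "s \<in> {A_plus, S_plus}" for s
  proof
    assume "sublist [s, S_star, S_plus] (sepr B)"
    then obtain k where k: "sepr_term B k = s" "sepr_term B (k + 1) = S_star"
      "sepr_term B (k + 2) = S_plus"
      by (rule sepr_sublistE)
    have minors: "principal_minors B l = {det (col_select B \<gamma>) | \<gamma>. \<gamma> \<subseteq> {..<n} \<and> card \<gamma> = l}" for l
      using assms(1) det_col_select_eq_det_submatrix[OF assms(1)]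
      by (auto simp: principal_minors_def principal_minor_def) metis+
    have nonneg: "0 \<le> det (col_select B \<gamma>)"
      if "\<gamma> \<subseteq> {..<n}" "card \<gamma> = l" "l = k \<or> l = k + 2" for \<gamma> l
      using that k s by (intro sepr_term_plus_nonneg[of B l]) (auto simp: minors)
    obtain \<alpha> \<beta> where "\<alpha> \<subseteq> {..<n}" "card \<alpha> = k + 1" "0 < det (col_select B \<alpha>)"
      "\<beta> \<subseteq> {..<n}" "card \<beta> = k + 1" "det (col_select B \<beta>) < 0"
      using sepr_term_S_starD[OF k(2)] unfolding minors by blast
    then show False
      using hermitian_minors_no_sign_change[OF assms(1) hermitian_index[OF assms], of k \<beta> \<alpha>]
        nonneg by blast
  qed
  then show ?thesis
    by blast
qed

end
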